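(* For every $r\ge0$ there is a balanced map $\varepsilon_r:[q_r]\to\{0,1\}$ (that is, each of the values $0,1$ is attained exactly $q_r/2$ times), and there are two marker-grid piercing sets $S_r^0,S_r^1\subseteq[q_r]\times[q_r]$ for $P_r$, such that for every $s\in[q_r]$ and $\delta\in\{0,1\}$, $$d^x_{S_r^\delta}(s)=d^y_{S_r^\delta}(s)=2+\mathbf 1_{\varepsilon_r(s)=\delta}.$$ In particular, $|S_r^\delta|=\frac52 q_r$.
   Context: All rectangles are closed and axis-parallel. Construction of $P_r$. Write $[q]=\{0,1,\dots,q-1\}$. Each $P_r$ is a finite rectangle family drawn in a square $[0,L]^2$ together with $q=q_r$ vertical marker lines $x=\xi_0,\dots,x=\xi_{q-1}$ and $q$ horizontal marker lines $y=\eta_0,\dots,y=\eta_{q-1}$ (in increasing order). Base: $P_0$ has $L=30$, $q=4$, $\xi=(3,11,19,27)$, $\eta=(3,11,21,27)$ and consists of the eight rectangles $T=[0,30]\times[26,28]$, $U_L=[0,16]\times[20,22]$, $U_R=[14,30]\times[20,22]$, $C_0=[0,8]\times[2,10]$, $C_1=[6,16]\times[8,14]$, $C_2=[14,24]\times[8,14]$, $C_3=[22,30]\times[2,12]$, $Q=[6,24]\times[0,4]$. Crossbar step: given $P$ with data $L,q,\xi,\eta$, put $M=L+1$, and for $R=[x_1,x_2]\times[y_1,y_2]\in P$ and $i,j\in[q]$ let $$H_i(R)=[Mx_1,Mx_2]\times[M\xi_i+y_1,M\xi_i+y_2],\qquad V_j(R)=[M\xi_j+y_1,M\xi_j+y_2]\times[Mx_1,Mx_2].$$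 $C(P)$ is the family of all $H_i(R)$ and $V_j(R)$ with $R\in P$, $i,j\in[q]$. It is drawn in $[0,ML+L]^2$, with $q^2$ vertical markers $\xi'_{(j,t)}=M\xi_j+\eta_t$ and $q^2$ horizontal markers $\eta'_{(i,t)}=M\xi_i+\eta_t$, indexed by $[q]\times[q]$, ordered lexicographically and thereby identified with $[q^2]$. Recursion: $P_{r+1}=C(P_r)$ for $r\ge0$; $q_0=4$, $q_{r+1}=q_r^2$, so $q_r=4^{2^r}$. For $R\in P_r$, $X_r(R)\subseteq[q_r]$ is the set of $s$ with $\xi_s$ in the $x$-interval of $R$, and $Y_r(R)\subseteq[q_r]$ is the set of $t$ with $\eta_t$ in the $y$-interval of $R$. The pair $(s,t)\in[q_r]\times[q_r]$ stands for the marker-grid point $(\xi_s,\eta_t)$. A set $S\subseteq[q_r]\times[q_r]$ is a marker-grid piercing set for $P_r$ if $S\cap(X_r(R)\times Y_r(R))\neq\emptyset$ for every $R\in P_r$. For such $S$, $d^x_S(s)=|\{t:(s,t)\in S\}|$ and $d^y_S(t)=|\{s:(s,t)\in S\}|$. $\mathbf 1_A$ is $1$ if $A$ holds and $0$ otherwise. *)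

theory Defs
  imports Complex_Main
begin

text \<open>\<open>Rect a b c d\<close> stands for the closed rectangle \<open>[a, b] \<times> [c, d]\<close>.\<close>

datatype rect = Rect (x_lo: real) (x_hi: real) (y_lo: real) (y_hi: real)

definition x_interval :: "rect \<Rightarrow> real set" where
  "x_interval R = {x_lo R..x_hi R}"

definition y_interval :: "rect \<Rightarrow> real set" where
  "y_interval R = {y_lo R..y_hi R}"

text \<open>A rectangle family drawn in the square \<open>[0, side]\<^sup>2\<close>. The marker functions are only
  meaningful at indices below \<open>nmarks\<close>.\<close>

record drawing =
  rects :: "rect set"
  side :: real
  nmarks :: nat
  xmark :: "nat \<Rightarrow> real"
  ymark :: "nat \<Rightarrow> real"

definition base_drawing :: drawing where
  "base_drawing = \<lparr>
     rects = {Rect 0 30 26 28, Rect 0 16 20 22, Rect 14 30 20 22, Rect 0 8 2 10,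
              Rect 6 16 8 14, Rect 14 24 8 14, Rect 22 30 2 12, Rect 6 24 0 4},
     side = 30,
     nmarks = 4,
     xmark = (\<lambda>s. [3, 11, 19, 27] ! s),
     ymark = (\<lambda>t. [3, 11, 21, 27] ! t)\<rparr>"

definition horizontal_copy :: "drawing \<Rightarrow> nat \<Rightarrow> rect \<Rightarrow> rect" where
  "horizontal_copy P i R = (let M = side P + 1 in
     Rect (M * x_lo R) (M * x_hi R) (M * xmark P i + y_lo R) (M * xmark P i + y_hi R))"

definition vertical_copy :: "drawing \<Rightarrow> nat \<Rightarrow> rect \<Rightarrow> rect" where
  "vertical_copy P j R = (let M = side P + 1 in
     Rect (M * xmark P j + y_lo R) (M * xmark P j + y_hi R) (M * x_lo R) (M * x_hi R))"

text \<open>With \<open>q = nmarks P\<close>, the pair \<open>(j, t)\<close> is at position \<open>j * q + t\<close> in the lexicographic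
  order, so the index \<open>k < q\<^sup>2\<close> stands for \<open>(k div q, k mod q)\<close>. The horizontal and the vertical
  markers have the same positions, both built from \<open>xmark P\<close> on the coarse and \<open>ymark P\<close> on the
  fine scale.\<close>

definition crossbar :: "drawing \<Rightarrow> drawing" where
  "crossbar P = (let M = side P + 1; q = nmarks P in \<lparr>
     rects = {horizontal_copy P i R | i R. i < q \<and> R \<in> rects P}
           \<union> {vertical_copy P j R | j R. j < q \<and> R \<in> rects P},
     side = M * side P + side P,
     nmarks = q\<^sup>2,
     xmark = (\<lambda>k. M * xmark P (k div q) + ymark P (k mod q)),
     ymark = (\<lambda>k. M * xmark P (k div q) + ymark P (k mod q))\<rparr>)"

primrec P_fam :: "nat \<Rightarrow> drawing" where
  "P_fam 0 = base_drawing"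
| "P_fam (Suc r) = crossbar (P_fam r)"

abbreviation q_num :: "nat \<Rightarrow> nat" where
  "q_num r \<equiv> nmarks (P_fam r)"

lemma q_num_eq: "q_num r = 4 ^ 2 ^ r"
  by (induction r)
    (simp_all add: base_drawing_def crossbar_def Let_def power_mult [symmetric] mult.commute)

definition X_set :: "drawing \<Rightarrow> rect \<Rightarrow> nat set" where
  "X_set P R = {s. s < nmarks P \<and> xmark P s \<in> x_interval R}"

definition Y_set :: "drawing \<Rightarrow> rect \<Rightarrow> nat set" where
  "Y_set P R = {t. t < nmarks P \<and> ymark P t \<in> y_interval R}"

definition marker_grid_piercing :: "drawing \<Rightarrow> (nat \<times> nat) set \<Rightarrow> bool" where
  "marker_grid_piercing P S \<longleftrightarrow>
     S \<subseteq> {..<nmarks P} \<times> {..<nmarks P} \<and>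
     (\<forall>R\<in>rects P. S \<inter> (X_set P R \<times> Y_set P R) \<noteq> {})"

definition deg_x :: "(nat \<times> nat) set \<Rightarrow> nat \<Rightarrow> nat" where
  "deg_x S s = card {t. (s, t) \<in> S}"

definition deg_y :: "(nat \<times> nat) set \<Rightarrow> nat \<Rightarrow> nat" where
  "deg_y S t = card {s. (s, t) \<in> S}"

definition balanced :: "nat \<Rightarrow> (nat \<Rightarrow> nat) \<Rightarrow> bool" where
  "balanced q \<epsilon> \<longleftrightarrow>
     (\<forall>s<q. \<epsilon> s \<in> {0, 1}) \<and>
     (\<forall>v\<in>{0, 1}. real (card {s. s < q \<and> \<epsilon> s = v}) = real q / 2)"

end

theory Submission
  imports Defs
begin

text \<open>The proof is by induction on \<open>r\<close>; everything happens in the crossbar step.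

  Let \<open>q\<close> be the number of markers of \<open>P\<close>. A point of the marker grid of \<open>crossbar P\<close> has an
  \<open>x\<close>-index \<open>(j, u)\<close> and a \<open>y\<close>-index \<open>(i, t)\<close>. If \<open>(j, t)\<close> lies in the box of \<open>R\<close> in the grid of
  \<open>P\<close>, this point pierces the horizontal copy of \<open>R\<close> in row \<open>i\<close>, whatever \<open>u\<close> is; if \<open>(i, u)\<close>
  does, it pierces the vertical copy of \<open>R\<close> in column \<open>j\<close>, whatever \<open>t\<close> is. One point can thus
  do two jobs. Attach a piercing set \<open>T i\<close> of \<open>P\<close> to each \<open>i < q\<close>, and use it both for row \<open>i\<close> and
  for column \<open>i\<close>. In the cell where row \<open>i\<close> meets column \<open>j\<close>, the values \<open>t\<close> with \<open>(j, t) \<in> T i\<close>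
  and the values \<open>u\<close> with \<open>(i, u) \<in> T j\<close> have to be realised. When there are equally many of them,
  a bijection between them pairs them up without waste, and the resulting set has degree
  \<open>deg_y (T j) u\<close> at \<open>(j, u)\<close> in both directions (lemma \<open>matched_lift\<close>).

  The condition for this is \<open>deg_x (T i) j = deg_x (T j) i\<close>. Given \<open>\<epsilon>\<close> and the two sets \<open>S 0\<close>,
  \<open>S 1\<close> for \<open>P\<close>, take \<open>T i = S (\<epsilon> i + \<delta>)\<close>, with the sum modulo 2. Then \<open>deg_x (T i) j\<close> is 3 if
  \<open>\<epsilon> i + \<epsilon> j = \<delta>\<close> modulo 2 and is 2 otherwise, which is symmetric in \<open>i\<close> and \<open>j\<close>. The new set has
  degree 3 at \<open>(j, u)\<close> exactly if \<open>\<epsilon> j + \<epsilon> u = \<delta>\<close> modulo 2, so the new map is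
  \<open>(j, u) \<mapsto> \<epsilon> j + \<epsilon> u\<close>. It is balanced because it is so for each fixed \<open>j\<close>
  (lemma \<open>half_split_crossbar\<close>).

  "Whatever \<open>u\<close> is" needs the refined marker to stay inside the rectangle, so the induction
  carries piercing with a margin of 1 to the right of and above the marker.\<close>

section \<open>Merging a family of grid sets by matching\<close>

lemma pair_index_less:
  fixes j u q :: nat
  assumes "j < q" "u < q"
  shows "j * q + u < q\<^sup>2"
proof -
  have "j * q + u < Suc j * q"
    using assms by simp
  also have "\<dots> \<le> q * q"
    using assms by (intro mult_le_mono1) simp
  finally show ?thesis
    by (simp add: power2_eq_square)
qed

lemma pair_index_eq_iff:
  fixes j u i t q :: nat
  assumes "u < q" "t < q"
  shows "j * q + u = i * q + t \<longleftrightarrow> j = i \<and> u = t"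
proof
  assume eq: "j * q + u = i * q + t"
  then have "(j * q + u) div q = (i * q + t) div q" "(j * q + u) mod q = (i * q + t) mod q"
    by simp_all
  then show "j = i \<and> u = t"
    using assms by simp
qed simp

text \<open>The set \<open>U\<close> realises, with a single point each, one demand from row \<open>i\<close> and one from column
  \<open>j\<close>. Fix the \<open>x\<close>-index \<open>(j, u)\<close>: the cell \<open>(i, j)\<close> contributes a point over it exactly if \<open>u\<close> is
  among the demands of column \<open>j\<close> there, that is, if \<open>(i, u) \<in> T j\<close>. So the degree is the number of
  such \<open>i\<close>, and the same count applies to the \<open>y\<close>-indices.\<close>

lemma matched_lift:
  fixes T :: "nat \<Rightarrow> (nat \<times> nat) set" and q :: nat
  assumes grid: "\<And>i. i < q \<Longrightarrow> T i \<subseteq> {..<q} \<times> {..<q}"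
    and sym: "\<And>i j. i < q \<Longrightarrow> j < q \<Longrightarrow> deg_x (T i) j = deg_x (T j) i"
  obtains U where "U \<subseteq> {..<q\<^sup>2} \<times> {..<q\<^sup>2}"
    and "\<And>i j t. i < q \<Longrightarrow> (j, t) \<in> T i \<Longrightarrow> \<exists>u<q. (j * q + u, i * q + t) \<in> U"
    and "\<And>i j u. j < q \<Longrightarrow> (i, u) \<in> T j \<Longrightarrow> \<exists>t<q. (j * q + u, i * q + t) \<in> U"
    and "\<And>j u. j < q \<Longrightarrow> u < q \<Longrightarrow> deg_x U (j * q + u) = deg_y (T j) u"
    and "\<And>i t. i < q \<Longrightarrow> t < q \<Longrightarrow> deg_y U (i * q + t) = deg_y (T i) t"
proof -
  define A where "A i j = {u. (i, u) \<in> T j}" for i j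
  have A_less: "u < q" if "u \<in> A i j" "j < q" for u i j
    using grid[OF that(2)] that(1) by (auto simp: A_def)
  have "\<exists>f. bij_betw f (A i j) (A j i)" if "i < q" "j < q" for i j
  proof (rule finite_same_card_bij)
    show "finite (A i j)" "finite (A j i)"
      using A_less that by (auto intro: finite_subset[of _ "{..<q}"])
    show "card (A i j) = card (A j i)"
      using sym[OF that] by (simp add: A_def deg_x_def)
  qed
  then obtain f where f: "\<And>i j. i < q \<Longrightarrow> j < q \<Longrightarrow> bij_betw (f i j) (A i j) (A j i)"
    by metis
  define g where "g i j = inv_into (A i j) (f i j)" for i j
  have f_in: "f i j u \<in> A j i" and gf: "g i j (f i j u) = u"
    if "i < q" "j < q" "u \<in> A i j" for i j u
    using f[OF that(1,2)] that(3) bij_betwE bij_betw_inv_into_left unfolding g_def by fast+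
  have g_in: "g i j t \<in> A i j" and fg: "f i j (g i j t) = t"
    if "i < q" "j < q" "t \<in> A j i" for i j t
    using f[OF that(1,2)] that(3) bij_betwE[OF bij_betw_inv_into] bij_betw_inv_into_right
    unfolding g_def by fast+
  have f_less: "f i j u < q" if "i < q" "j < q" "u \<in> A i j" for i j u
    using A_less[OF f_in[OF that] that(1)] .
  define U where
    "U = {(j * q + u, i * q + f i j u) | i j u. i < q \<and> j < q \<and> u \<in> A i j}"
  show thesis
  proof (rule that[of U])
    show "U \<subseteq> {..<q\<^sup>2} \<times> {..<q\<^sup>2}"
      using A_less f_less by (auto simp: U_def intro!: pair_index_less)
    show "\<exists>u<q. (j * q + u, i * q + t) \<in> U" if "i < q" "(j, t) \<in> T i" for i j t
    proof -
      have "j < q" "t \<in> A j i"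
        using grid[OF that(1)] that(2) by (auto simp: A_def)
      then have "g i j t \<in> A i j" "f i j (g i j t) = t"
        using g_in fg that(1) by auto
      then show ?thesis
        using A_less[of "g i j t" i j] \<open>i < q\<close> \<open>j < q\<close> unfolding U_def
        by (intro exI[of _ "g i j t"]) force
    qed
    show "\<exists>t<q. (j * q + u, i * q + t) \<in> U" if "j < q" "(i, u) \<in> T j" for i j u
    proof -
      have "i < q" "u \<in> A i j"
        using grid[OF that(1)] that(2) by (auto simp: A_def)
      then show ?thesis
        using f_less[of i j u] \<open>j < q\<close> unfolding U_def
        by (intro exI[of _ "f i j u"]) blast
    qed
    show "deg_x U (j * q + u) = deg_y (T j) u" if "j < q" "u < q" for j u
    proof -
      let ?h = "\<lambda>i. i * q + f i j u"
      have lt: "i < q" "u \<in> A i j" "f i j u < q" if "(i, u) \<in> T j" for i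
      proof -
        show "i < q" "u \<in> A i j"
          using grid[OF \<open>j < q\<close>] that by (auto simp: A_def)
        then show "f i j u < q"
          using f_less \<open>j < q\<close> by blast
      qed
      have "{l. (j * q + u, l) \<in> U} = ?h ` {i. (i, u) \<in> T j}"
      proof (intro set_eqI iffI)
        fix l assume "l \<in> {l. (j * q + u, l) \<in> U}"
        then obtain i j' u' where *: "i < q" "j' < q" "u' \<in> A i j'"
            "j * q + u = j' * q + u'" "l = i * q + f i j' u'"
          by (auto simp: U_def)
        then have "j = j'" "u = u'"
          using pair_index_eq_iff[OF \<open>u < q\<close> A_less[OF *(3,2)]] by auto
        then show "l \<in> ?h ` {i. (i, u) \<in> T j}"
          using * by (auto simp: A_def)
      next
        fix l assume "l \<in> ?h ` {i. (i, u) \<in> T j}"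
        then obtain i where i: "(i, u) \<in> T j" "l = i * q + f i j u"
          by auto
        show "l \<in> {l. (j * q + u, l) \<in> U}"
          unfolding U_def i(2) using lt[OF i(1)] \<open>j < q\<close> by blast
      qed
      moreover have "inj_on ?h {i. (i, u) \<in> T j}"
        using lt by (auto simp: inj_on_def pair_index_eq_iff)
      ultimately show ?thesis
        by (simp add: deg_x_def deg_y_def card_image)
    qed
    show "deg_y U (i * q + t) = deg_y (T i) t" if "i < q" "t < q" for i t
    proof -
      let ?h = "\<lambda>j. j * q + g i j t"
      have lt: "j < q" "t \<in> A j i" "g i j t < q" if "(j, t) \<in> T i" for j
      proof -
        show "j < q" "t \<in> A j i"
          using grid[OF \<open>i < q\<close>] that by (auto simp: A_def)
        then show "g i j t < q"
          using A_less g_in \<open>i < q\<close> by blast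
      qed
      have "{k. (k, i * q + t) \<in> U} = ?h ` {j. (j, t) \<in> T i}"
      proof (intro set_eqI iffI)
        fix k assume "k \<in> {k. (k, i * q + t) \<in> U}"
        then obtain i' j u where *: "i' < q" "j < q" "u \<in> A i' j"
            "k = j * q + u" "i * q + t = i' * q + f i' j u"
          by (auto simp: U_def)
        then have "i = i'" "t = f i j u"
          using pair_index_eq_iff[OF \<open>t < q\<close> f_less[OF *(1-3)]] by auto
        moreover from this have "t \<in> A j i" "g i j t = u"
          using * f_in gf by auto
        ultimately show "k \<in> ?h ` {j. (j, t) \<in> T i}"
          using * by (intro image_eqI[of _ _ j]) (auto simp: A_def)
      next
        fix k assume "k \<in> ?h ` {j. (j, t) \<in> T i}"
        then obtain j where j: "(j, t) \<in> T i" "k = j * q + g i j t"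
          by auto
        with lt have "g i j t \<in> A i j" "f i j (g i j t) = t"
          using g_in fg \<open>i < q\<close> by auto
        then show "k \<in> {k. (k, i * q + t) \<in> U}"
          unfolding U_def using j lt(1)[OF j(1)] \<open>i < q\<close> by force
      qed
      moreover have "inj_on ?h {j. (j, t) \<in> T i}"
        using lt by (auto simp: inj_on_def pair_index_eq_iff)
      ultimately show ?thesis
        by (simp add: deg_y_def card_image)
    qed
  qed
qed

section \<open>Piercing with a margin\<close>

text \<open>The strip between a marker and its translate by 1 has to stay inside the rectangle. After
  scaling by \<open>M = side P + 1\<close>, the fine markers attached to a coarse marker all lie in this
  strip.\<close>

definition roomy_piercing :: "drawing \<Rightarrow> (nat \<times> nat) set \<Rightarrow> bool" where
  "roomy_piercing P S \<longleftrightarrow>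
     S \<subseteq> {..<nmarks P} \<times> {..<nmarks P} \<and>
     (\<forall>R\<in>rects P. \<exists>(s, t)\<in>S.
        x_lo R \<le> xmark P s \<and> xmark P s + 1 \<le> x_hi R \<and>
        y_lo R \<le> ymark P t \<and> ymark P t + 1 \<le> y_hi R)"

lemma marker_grid_piercing_if_roomy:
  assumes "roomy_piercing P S"
  shows "marker_grid_piercing P S"
  unfolding marker_grid_piercing_def
proof (intro conjI ballI)
  show grid: "S \<subseteq> {..<nmarks P} \<times> {..<nmarks P}"
    using assms by (simp add: roomy_piercing_def)
  fix R assume "R \<in> rects P"
  then obtain s t where "(s, t) \<in> S"
      "x_lo R \<le> xmark P s" "xmark P s + 1 \<le> x_hi R"
      "y_lo R \<le> ymark P t" "ymark P t + 1 \<le> y_hi R"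
    using assms unfolding roomy_piercing_def by blast
  then have "(s, t) \<in> S \<inter> (X_set P R \<times> Y_set P R)"
    using grid by (auto simp: X_set_def Y_set_def x_interval_def y_interval_def)
  then show "S \<inter> (X_set P R \<times> Y_set P R) \<noteq> {}"
    by blast
qed

definition markers_inside :: "drawing \<Rightarrow> bool" where
  "markers_inside P \<longleftrightarrow>
     0 \<le> side P \<and> (\<forall>s<nmarks P. xmark P s \<in> {0..side P} \<and> ymark P s \<in> {0..side P})"

lemma markers_inside_crossbar:
  assumes "markers_inside P"
  shows "markers_inside (crossbar P)"
proof -
  let ?M = "side P + 1" and ?q = "nmarks P"
  have "?M * xmark P (k div ?q) + ymark P (k mod ?q) \<in> {0..?M * side P + side P}"
    if "k < ?q\<^sup>2" for k
  proof -
    have "0 < ?q"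
      using that by (cases "?q = 0") auto
    then have "k div ?q < ?q" "k mod ?q < ?q"
      using that by (auto simp: power2_eq_square less_mult_imp_div_less)
    then show ?thesis
      using assms
      by (auto simp: markers_inside_def
          intro!: add_mono add_nonneg_nonneg mult_left_mono mult_nonneg_nonneg)
  qed
  then show ?thesis
    using assms by (simp add: markers_inside_def crossbar_def Let_def)
qed

lemma refined_marker_bounds:
  fixes L a b \<xi> \<eta> :: real
  assumes "a \<le> \<xi>" "\<xi> + 1 \<le> b" "0 \<le> \<eta>" "\<eta> \<le> L"
  shows "(L + 1) * a \<le> (L + 1) * \<xi> + \<eta>" "(L + 1) * \<xi> + \<eta> + 1 \<le> (L + 1) * b"
proof -
  have "(L + 1) * a \<le> (L + 1) * \<xi>" "(L + 1) * (\<xi> + 1) \<le> (L + 1) * b"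
    using assms by (auto intro!: mult_left_mono)
  then show "(L + 1) * a \<le> (L + 1) * \<xi> + \<eta>" "(L + 1) * \<xi> + \<eta> + 1 \<le> (L + 1) * b"
    using assms by (auto simp: algebra_simps)
qed

text \<open>The two conditions on \<open>U\<close> serve the horizontal copies (the fine index \<open>u\<close> is free) and the
  vertical copies (the fine index \<open>t\<close> is free).\<close>

lemma roomy_piercing_crossbar:
  assumes inside: "markers_inside P"
    and T: "\<And>i. i < nmarks P \<Longrightarrow> roomy_piercing P (T i)"
    and grid: "U \<subseteq> {..<(nmarks P)\<^sup>2} \<times> {..<(nmarks P)\<^sup>2}"
    and rows: "\<And>i j t. i < nmarks P \<Longrightarrow> (j, t) \<in> T i \<Longrightarrow>
      \<exists>u<nmarks P. (j * nmarks P + u, i * nmarks P + t) \<in> U"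
    and cols: "\<And>i j u. j < nmarks P \<Longrightarrow> (i, u) \<in> T j \<Longrightarrow>
      \<exists>t<nmarks P. (j * nmarks P + u, i * nmarks P + t) \<in> U"
  shows "roomy_piercing (crossbar P) U"
proof -
  let ?M = "side P + 1" and ?q = "nmarks P" and ?C = "crossbar P"
  have marks: "xmark ?C (j * ?q + u) = ?M * xmark P j + ymark P u"
      "ymark ?C (j * ?q + u) = ?M * xmark P j + ymark P u" if "u < ?q" for j u
    using that by (simp_all add: crossbar_def Let_def)
  have fine: "0 \<le> ymark P u" "ymark P u \<le> side P" if "u < ?q" for u
    using inside that by (auto simp: markers_inside_def)
  have T_meets: "\<exists>s t. (s, t) \<in> T i \<and> s < ?q \<and> t < ?q \<and>
      x_lo R \<le> xmark P s \<and> xmark P s + 1 \<le> x_hi R \<and>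
      y_lo R \<le> ymark P t \<and> ymark P t + 1 \<le> y_hi R" if "i < ?q" "R \<in> rects P" for i R
    using T[OF that(1)] that(2) unfolding roomy_piercing_def by fast
  have "\<exists>(k, l)\<in>U. x_lo R' \<le> xmark ?C k \<and> xmark ?C k + 1 \<le> x_hi R' \<and>
      y_lo R' \<le> ymark ?C l \<and> ymark ?C l + 1 \<le> y_hi R'" if R': "R' \<in> rects ?C" for R'
  proof -
    from R' consider
        (horizontal) i R where "i < ?q" "R \<in> rects P" "R' = horizontal_copy P i R"
      | (vertical) j R where "j < ?q" "R \<in> rects P" "R' = vertical_copy P j R"
      by (auto simp: crossbar_def Let_def)
    then show ?thesis
    proof cases
      case horizontal
      obtain j t where jt: "(j, t) \<in> T i" "t < ?q"
          "x_lo R \<le> xmark P j" "xmark P j + 1 \<le> x_hi R"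
          "y_lo R \<le> ymark P t" "ymark P t + 1 \<le> y_hi R"
        using T_meets[OF horizontal(1,2)] by blast
      obtain u where u: "u < ?q" "(j * ?q + u, i * ?q + t) \<in> U"
        using rows[OF horizontal(1) jt(1)] by blast
      show ?thesis
        using jt(5,6) refined_marker_bounds[OF jt(3,4) fine[OF u(1)]]
        by (intro bexI[OF _ u(2)])
          (simp add: marks u(1) jt(2) horizontal(3) horizontal_copy_def Let_def)
    next
      case vertical
      obtain i u where iu: "(i, u) \<in> T j" "u < ?q"
          "x_lo R \<le> xmark P i" "xmark P i + 1 \<le> x_hi R"
          "y_lo R \<le> ymark P u" "ymark P u + 1 \<le> y_hi R"
        using T_meets[OF vertical(1,2)] by blast
      obtain t where t: "t < ?q" "(j * ?q + u, i * ?q + t) \<in> U"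
        using cols[OF vertical(1) iu(1)] by blast
      show ?thesis
        using iu(5,6) refined_marker_bounds[OF iu(3,4) fine[OF t(1)]]
        by (intro bexI[OF _ t(2)])
          (simp add: marks t(1) iu(2) vertical(3) vertical_copy_def Let_def)
    qed
  qed
  then show ?thesis
    using grid by (simp add: roomy_piercing_def crossbar_def Let_def)
qed

section \<open>The induction\<close>

definition half_split :: "drawing \<Rightarrow> (nat \<Rightarrow> nat) \<Rightarrow> (nat \<Rightarrow> (nat \<times> nat) set) \<Rightarrow> bool" where
  "half_split P \<epsilon> S \<longleftrightarrow>
     balanced (nmarks P) \<epsilon> \<and>
     (\<forall>\<delta>\<in>{0, 1}. roomy_piercing P (S \<delta>)) \<and>
     (\<forall>\<delta>\<in>{0, 1}. \<forall>s<nmarks P.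
        deg_x (S \<delta>) s = 2 + (if \<epsilon> s = \<delta> then 1 else 0) \<and>
        deg_y (S \<delta>) s = 2 + (if \<epsilon> s = \<delta> then 1 else 0))"

lemma add_mod_2_eq_iff:
  fixes a b c :: nat
  assumes "a \<in> {0, 1}" "b \<in> {0, 1}" "c \<in> {0, 1}"
  shows "(a + b) mod 2 = c \<longleftrightarrow> b = (a + c) mod 2"
  using assms by auto

text \<open>Adding a constant modulo 2 to a balanced map leaves it balanced, so each of the \<open>q\<close> blocks
  contributes \<open>q / 2\<close> indices to either value.\<close>

lemma balanced_block_sum:
  assumes "balanced q \<epsilon>"
  shows "balanced (q\<^sup>2) (\<lambda>k. (\<epsilon> (k div q) + \<epsilon> (k mod q)) mod 2)"
proof -
  have bit: "\<epsilon> s \<in> {0, 1}" if "s < q" for s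
    using assms that by (simp add: balanced_def)
  have half: "real (card {s. s < q \<and> \<epsilon> s = v}) = real q / 2" if "v \<in> {0, 1}" for v
    using assms that unfolding balanced_def by blast
  have "real (card {k. k < q\<^sup>2 \<and> (\<epsilon> (k div q) + \<epsilon> (k mod q)) mod 2 = v}) = real (q\<^sup>2) / 2"
    if v: "v \<in> {0, 1}" for v
  proof -
    let ?B = "\<lambda>i. {t. t < q \<and> \<epsilon> t = (\<epsilon> i + v) mod 2}"
    have "{k. k < q\<^sup>2 \<and> (\<epsilon> (k div q) + \<epsilon> (k mod q)) mod 2 = v} =
        (\<lambda>(i, t). i * q + t) ` (SIGMA i:{..<q}. ?B i)" (is "?K = ?h ` _")
    proof (intro set_eqI iffI)
      fix k assume k: "k \<in> ?K"
      then have "0 < q"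
        by (cases "q = 0") auto
      then have "k div q < q" "k mod q < q"
        using k by (auto simp: power2_eq_square less_mult_imp_div_less)
      moreover from this have "\<epsilon> (k mod q) = (\<epsilon> (k div q) + v) mod 2"
        using k add_mod_2_eq_iff[OF bit bit v] by auto
      ultimately show "k \<in> ?h ` (SIGMA i:{..<q}. ?B i)"
        by (intro image_eqI[of _ _ "(k div q, k mod q)"]) auto
    next
      fix k assume "k \<in> ?h ` (SIGMA i:{..<q}. ?B i)"
      then obtain i t where *: "i < q" "t < q" "\<epsilon> t = (\<epsilon> i + v) mod 2" "k = i * q + t"
        by auto
      then have "(\<epsilon> i + \<epsilon> t) mod 2 = v"
        using add_mod_2_eq_iff[OF bit bit v] by blast
      then show "k \<in> ?K"
        using * by (simp add: pair_index_less)
    qed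
    moreover have "inj_on ?h (SIGMA i:{..<q}. ?B i)"
      by (auto simp: inj_on_def pair_index_eq_iff)
    ultimately have "real (card ?K) = (\<Sum>i<q. real (card (?B i)))"
      by (simp add: card_image)
    also have "\<dots> = (\<Sum>i<q. real q / 2)"
      by (intro sum.cong refl half) auto
    finally show ?thesis
      by (simp add: power2_eq_square)
  qed
  then show ?thesis
    by (auto simp: balanced_def)
qed

lemma half_split_crossbar:
  assumes inside: "markers_inside P" and split: "half_split P \<epsilon> S"
  shows "\<exists>\<epsilon>' S'. half_split (crossbar P) \<epsilon>' S'"
proof -
  let ?q = "nmarks P"
  let ?e = "\<lambda>k. (\<epsilon> (k div ?q) + \<epsilon> (k mod ?q)) mod 2"
  have bal: "balanced ?q \<epsilon>"
    and roomy: "\<And>\<delta>. \<delta> \<in> {0, 1} \<Longrightarrow> roomy_piercing P (S \<delta>)"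
    and deg: "\<And>\<delta> s. \<delta> \<in> {0, 1} \<Longrightarrow> s < ?q \<Longrightarrow> deg_x (S \<delta>) s = 2 + (if \<epsilon> s = \<delta> then 1 else 0)"
      "\<And>\<delta> s. \<delta> \<in> {0, 1} \<Longrightarrow> s < ?q \<Longrightarrow> deg_y (S \<delta>) s = 2 + (if \<epsilon> s = \<delta> then 1 else 0)"
    using split by (auto simp: half_split_def)
  have bit: "\<epsilon> s \<in> {0, 1}" if "s < ?q" for s
    using bal that by (simp add: balanced_def)
  have "\<exists>U. roomy_piercing (crossbar P) U \<and>
      (\<forall>k<?q\<^sup>2. deg_x U k = 2 + (if ?e k = \<delta> then 1 else 0) \<and>
        deg_y U k = 2 + (if ?e k = \<delta> then 1 else 0))" if \<delta>: "\<delta> \<in> {0, 1}" for \<delta>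
  proof -
    define T where "T i = S ((\<epsilon> i + \<delta>) mod 2)" for i
    have idx: "(\<epsilon> i + \<delta>) mod 2 \<in> {0, 1}" for i
      by auto
    have T_roomy: "roomy_piercing P (T i)" for i
      unfolding T_def by (intro roomy idx)
    have T_deg: "deg_x (T i) j = 2 + (if (\<epsilon> i + \<epsilon> j) mod 2 = \<delta> then 1 else 0)"
        "deg_y (T i) j = 2 + (if (\<epsilon> i + \<epsilon> j) mod 2 = \<delta> then 1 else 0)"
      if "i < ?q" "j < ?q" for i j
      using that by (simp_all only: T_def deg[OF idx] add_mod_2_eq_iff[OF bit bit \<delta>])
    obtain U where U: "U \<subseteq> {..<?q\<^sup>2} \<times> {..<?q\<^sup>2}"
      "\<And>i j t. i < ?q \<Longrightarrow> (j, t) \<in> T i \<Longrightarrow> \<exists>u<?q. (j * ?q + u, i * ?q + t) \<in> U"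
      "\<And>i j u. j < ?q \<Longrightarrow> (i, u) \<in> T j \<Longrightarrow> \<exists>t<?q. (j * ?q + u, i * ?q + t) \<in> U"
      "\<And>j u. j < ?q \<Longrightarrow> u < ?q \<Longrightarrow> deg_x U (j * ?q + u) = deg_y (T j) u"
      "\<And>i t. i < ?q \<Longrightarrow> t < ?q \<Longrightarrow> deg_y U (i * ?q + t) = deg_y (T i) t"
    proof (rule matched_lift[of ?q T])
      show "T i \<subseteq> {..<?q} \<times> {..<?q}" for i
        using T_roomy by (simp add: roomy_piercing_def)
      show "deg_x (T i) j = deg_x (T j) i" if "i < ?q" "j < ?q" for i j
        using that by (simp add: T_deg add.commute)
    qed blast
    have "deg_x U k = 2 + (if ?e k = \<delta> then 1 else 0) \<and>
        deg_y U k = 2 + (if ?e k = \<delta> then 1 else 0)" if k: "k < ?q\<^sup>2" for k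
    proof -
      have "0 < ?q"
        using k by (cases "?q = 0") auto
      then have lt: "k div ?q < ?q" "k mod ?q < ?q"
        using k by (auto simp: power2_eq_square less_mult_imp_div_less)
      show ?thesis
        using U(4)[OF lt] U(5)[OF lt] T_deg(2)[OF lt] by simp
    qed
    moreover have "roomy_piercing (crossbar P) U"
      using inside T_roomy U(1-3) by (rule roomy_piercing_crossbar)
    ultimately show ?thesis
      by blast
  qed
  then have "\<forall>\<delta>\<in>{0, 1}. \<exists>U. roomy_piercing (crossbar P) U \<and>
      (\<forall>k<?q\<^sup>2. deg_x U k = 2 + (if ?e k = \<delta> then 1 else 0) \<and>
        deg_y U k = 2 + (if ?e k = \<delta> then 1 else 0))"
    by blast
  then obtain S' where S': "\<forall>\<delta>\<in>{0, 1}. roomy_piercing (crossbar P) (S' \<delta>) \<and>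
      (\<forall>k<?q\<^sup>2. deg_x (S' \<delta>) k = 2 + (if ?e k = \<delta> then 1 else 0) \<and>
        deg_y (S' \<delta>) k = 2 + (if ?e k = \<delta> then 1 else 0))"
    by (rule bchoice[THEN exE])
  have marks: "nmarks (crossbar P) = ?q\<^sup>2"
    by (simp add: crossbar_def Let_def)
  have "half_split (crossbar P) ?e S'"
    unfolding half_split_def marks using balanced_block_sum[OF bal] S' by blast
  then show ?thesis
    by blast
qed

text \<open>The two sets were found by exhaustive search. The points \<open>(0, 0)\<close>, \<open>(1, 1)\<close> and \<open>(2, 1)\<close>
  are forced by \<open>C\<^sub>0\<close>, \<open>C\<^sub>1\<close> and \<open>C\<^sub>2\<close>, which contain a single grid point each.\<close>

definition base_set :: "nat \<Rightarrow> (nat \<times> nat) set" where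
  "base_set \<delta> = (if \<delta> = 0
     then {(0, 0), (0, 2), (0, 3), (1, 0), (1, 1), (2, 1), (2, 2), (2, 3), (3, 0), (3, 2)}
     else {(0, 0), (0, 2), (1, 0), (1, 1), (1, 3), (2, 1), (2, 3), (3, 1), (3, 2), (3, 3)})"

lemma half_split_base: "half_split base_drawing (\<lambda>s. s mod 2) base_set"
proof -
  have less_4: "s < 4 \<longleftrightarrow> s = 0 \<or> s = 1 \<or> s = 2 \<or> s = 3" for s :: nat
    by auto
  have "real (card {s. s < 4 \<and> s mod 2 = v}) = real 4 / 2" if "v \<in> {0, 1}" for v :: nat
  proof -
    have "{s. s < 4 \<and> s mod 2 = v} = {v, v + 2}"
      using that by (auto simp: less_4)
    then show ?thesis
      by simp
  qed
  moreover have "s mod 2 \<in> {0, 1}" for s :: nat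
    by auto
  ultimately have "balanced 4 (\<lambda>s. s mod 2)"
    unfolding balanced_def by blast
  moreover have "roomy_piercing base_drawing (base_set \<delta>)" if "\<delta> \<in> {0, 1}" for \<delta>
    using that unfolding insert_iff empty_iff
    by (elim disjE; simp add: roomy_piercing_def base_drawing_def base_set_def)
  moreover have "deg_x (base_set \<delta>) s = 2 + (if s mod 2 = \<delta> then 1 else 0)"
      "deg_y (base_set \<delta>) s = 2 + (if s mod 2 = \<delta> then 1 else 0)"
    if "\<delta> \<in> {0, 1}" "s < 4" for \<delta> s
    using that unfolding less_4 insert_iff empty_iff
    by (elim disjE; simp add: deg_x_def deg_y_def base_set_def Collect_disj_eq)+
  ultimately show ?thesis
    by (simp add: half_split_def base_drawing_def)
qed

lemma half_split_P_fam: "markers_inside (P_fam r) \<and> (\<exists>\<epsilon> S. half_split (P_fam r) \<epsilon> S)"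
proof (induction r)
  case 0
  have "markers_inside base_drawing"
    by (auto simp: markers_inside_def base_drawing_def less_Suc_eq numeral_eq_Suc)
  then show ?case
    using half_split_base by auto
next
  case (Suc r)
  then show ?case
    using markers_inside_crossbar half_split_crossbar by auto
qed

lemma card_eq_sum_deg_x:
  assumes "S \<subseteq> {..<q} \<times> {..<q}"
  shows "card S = (\<Sum>s<q. deg_x S s)"
proof -
  have "finite {t. (s, t) \<in> S}" for s
    by (rule finite_subset[of _ "{..<q}"]) (use assms in auto)
  moreover have "S = (SIGMA s:{..<q}. {t. (s, t) \<in> S})"
    using assms by auto
  ultimately show ?thesis
    unfolding deg_x_def by (metis card_SigmaI finite_lessThan)
qed

theorem lemma20:
  shows "\<forall>r. \<exists>\<epsilon> :: nat \<Rightarrow> nat. \<exists>S :: nat \<Rightarrow> (nat \<times> nat) set.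
    balanced (q_num r) \<epsilon> \<and>
    (\<forall>\<delta>\<in>{0, 1}. marker_grid_piercing (P_fam r) (S \<delta>)) \<and>
    (\<forall>s<q_num r. \<forall>\<delta>\<in>{0, 1}.
       deg_x (S \<delta>) s = 2 + (if \<epsilon> s = \<delta> then 1 else 0) \<and>
       deg_y (S \<delta>) s = 2 + (if \<epsilon> s = \<delta> then 1 else 0)) \<and>
    (\<forall>\<delta>\<in>{0, 1}. real (card (S \<delta>)) = 5 / 2 * real (q_num r))"
proof
  fix r
  let ?q = "q_num r"
  obtain \<epsilon> S where split: "half_split (P_fam r) \<epsilon> S"
    using half_split_P_fam by blast
  have card: "\<forall>\<delta>\<in>{0, 1}. real (card (S \<delta>)) = 5 / 2 * real ?q"
  proof
    fix \<delta> :: nat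
    assume \<delta>: "\<delta> \<in> {0, 1}"
    have "card (S \<delta>) = (\<Sum>s<?q. deg_x (S \<delta>) s)"
      using split \<delta> by (intro card_eq_sum_deg_x) (auto simp: half_split_def roomy_piercing_def)
    also have "\<dots> = (\<Sum>s<?q. 2 + (if \<epsilon> s = \<delta> then 1 else 0))"
      using split \<delta> by (intro sum.cong) (auto simp: half_split_def)
    also have "\<dots> = 2 * ?q + card {s. s < ?q \<and> \<epsilon> s = \<delta>}"
      unfolding sum.distrib by (simp add: sum.If_cases Int_def)
    finally show "real (card (S \<delta>)) = 5 / 2 * real ?q"
      using split \<delta> by (auto simp: half_split_def balanced_def)
  qed
  have "\<forall>\<delta>\<in>{0, 1}. marker_grid_piercing (P_fam r) (S \<delta>)"
    using split marker_grid_piercing_if_roomy unfolding half_split_def by blast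
  with split card show "\<exists>\<epsilon> :: nat \<Rightarrow> nat. \<exists>S :: nat \<Rightarrow> (nat \<times> nat) set.
    balanced ?q \<epsilon> \<and>
    (\<forall>\<delta>\<in>{0, 1}. marker_grid_piercing (P_fam r) (S \<delta>)) \<and>
    (\<forall>s<?q. \<forall>\<delta>\<in>{0, 1}.
       deg_x (S \<delta>) s = 2 + (if \<epsilon> s = \<delta> then 1 else 0) \<and>
       deg_y (S \<delta>) s = 2 + (if \<epsilon> s = \<delta> then 1 else 0)) \<and>
    (\<forall>\<delta>\<in>{0, 1}. real (card (S \<delta>)) = 5 / 2 * real ?q)"
    unfolding half_split_def by (intro exI[of _ \<epsilon>] exI[of _ S] conjI) blast+
qed

end
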